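(* Let $n\geq 4$ and let $AG_n=\mathrm{Cay}(A_n,T_1)$ be the alternating group graph, where $T_1=\{(1,2,i),(1,i,2)\mid 3\leq i\leq n\}$. Then the two largest eigenvalues of $AG_n$ are $\lambda_1(AG_n)=2n-4$ and $\lambda_2(AG_n)=2n-6$.
   Context: $A_n$ is the alternating group on $\{1,\ldots,n\}$; $(i,j,k)$ denotes the 3-cycle $i\mapsto j\mapsto k\mapsto i$. Products of permutations are read left to right: $\sigma\tau$ means first apply $\sigma$, then $\tau$. For a finite group $\Gamma$ with identity $e$ and a subset $T\subseteq\Gamma\setminus\{e\}$ with $T=T^{-1}$, the Cayley graph $\mathrm{Cay}(\Gamma,T)$ is the undirected graph with vertex set $\Gamma$ and edge set $\{\{\gamma,t\gamma\}\mid \gamma\in\Gamma,\ t\in T\}$. The eigenvalues of a graph $G$ on $N$ vertices are those of its adjacency matrix, listed with multiplicity as $\lambda_1(G)\geq\lambda_2(G)\geq\cdots\geq\lambda_N(G)$. *)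

theory Defs
  imports
    "HOL-Algebra.Sym_Groups"
    "HOL-Computational_Algebra.Polynomial"
    "HOL-Library.Multiset"
    "Jordan_Normal_Form.Char_Poly"
begin

section \<open>Graphs and their eigenvalues\<close>

text \<open>A simple graph is a pair of a vertex set and a set of two-element edges.\<close>

type_synonym 'a graph = "'a set \<times> 'a set set"

abbreviation verts :: "'a graph \<Rightarrow> 'a set" where "verts G \<equiv> fst G"
abbreviation edges :: "'a graph \<Rightarrow> 'a set set" where "edges G \<equiv> snd G"

text \<open>Matrices are indexed from 0, so the adjacency matrix is taken with respect to an
  enumeration of the vertices.\<close>

definition adj_matrix :: "'a graph \<Rightarrow> 'a list \<Rightarrow> real mat" where
  "adj_matrix G vs = mat (length vs) (length vs)
     (\<lambda>(i, j). if {vs ! i, vs ! j} \<in> edges G then 1 else 0)"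

text \<open>The choice of the enumeration is irrelevant, see \<open>graph_char_poly_eq\<close> below.\<close>

definition graph_char_poly :: "'a graph \<Rightarrow> real poly" where
  "graph_char_poly G =
     char_poly (adj_matrix G (SOME vs. distinct vs \<and> set vs = verts G))"

text \<open>All eigenvalues with multiplicity, in descending order. The adjacency matrix is real
  symmetric, so its characteristic polynomial has no roots outside the reals, and algebraic and
  geometric multiplicities agree.\<close>

definition graph_eigenvalues :: "'a graph \<Rightarrow> real list" where
  "graph_eigenvalues G = rev (sorted_list_of_multiset (proots (graph_char_poly G)))"

text \<open>The numbering of the eigenvalues starts at 1; only indices between 1 and the number of
  vertices are meaningful.\<close>

definition graph_eigenvalue :: "nat \<Rightarrow> 'a graph \<Rightarrow> real" where
  "graph_eigenvalue k G = graph_eigenvalues G ! (k - 1)"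

lemma det_permute_both:
  fixes A :: "'b :: comm_ring_1 mat"
  assumes A: "A \<in> carrier_mat n n" and p: "p permutes {0..<n}"
  shows "det (mat n n (\<lambda>(i, j). A $$ (p i, p j))) = det A"
proof -
  have pn: "p i < n" if "i < n" for i
    using permutes_in_image[OF p, of i] that by simp
  let ?B = "mat n n (\<lambda>(i, j). A $$ (p i, j))"
  let ?C = "mat n n (\<lambda>(i, j). ?B\<^sup>T $$ (p i, j))"
  have B: "?B\<^sup>T \<in> carrier_mat n n" by simp
  have C: "mat n n (\<lambda>(i, j). A $$ (p i, p j)) = ?C\<^sup>T"
    by (rule eq_matI) (auto simp: pn)
  have "det (mat n n (\<lambda>(i, j). A $$ (p i, p j))) = det ?C"
    unfolding C by (rule det_transpose[of _ n]) simp
  also have "\<dots> = signof p * det (?B\<^sup>T)"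
    by (rule det_permute_rows[OF B p])
  also have "det (?B\<^sup>T) = det ?B"
    by (rule det_transpose[of _ n]) simp
  also have "det ?B = signof p * det A"
    by (rule det_permute_rows[OF A p])
  finally show ?thesis
    by (simp add: sign_def)
qed

lemma char_poly_adj_matrix_unique:
  assumes vs: "distinct vs" "set vs = verts G" and ws: "distinct ws" "set ws = verts G"
  shows "char_poly (adj_matrix G vs) = char_poly (adj_matrix G ws)"
proof -
  have "mset vs = mset ws"
    using assms by (metis set_eq_iff_mset_eq_distinct)
  then obtain p where p: "p permutes {..<length ws}" and pvs: "permute_list p ws = vs"
    by (rule mset_eq_permutation)
  define n where "n = length ws"
  have len: "length vs = n" using pvs n_def by auto
  have p': "p permutes {0..<n}" using p by (simp add: n_def atLeast0LessThan)
  have pn: "p i < n" if "i < n" for i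
    using permutes_in_image[OF p', of i] that by simp
  have nth: "vs ! i = ws ! p i" if "i < n" for i
    using pvs permute_list_nth[OF p, of i] that by (simp add: n_def)
  have inj: "p i = p j \<longleftrightarrow> i = j" for i j
    using permutes_inj[OF p'] by (auto simp: inj_def)
  let ?A = "char_poly_matrix (adj_matrix G ws)"
  have "char_poly_matrix (adj_matrix G vs) = mat n n (\<lambda>(i, j). ?A $$ (p i, p j))"
    by (rule eq_matI)
      (auto simp: char_poly_matrix_def adj_matrix_def len n_def[symmetric] pn nth inj)
  moreover have "?A \<in> carrier_mat n n"
    by (simp add: adj_matrix_def n_def char_poly_matrix_def)
  ultimately show ?thesis
    using det_permute_both[OF _ p'] by (simp add: char_poly_def)
qed

lemma graph_char_poly_eq:
  assumes "distinct vs" "set vs = verts G"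
  shows "graph_char_poly G = char_poly (adj_matrix G vs)"
proof -
  have "distinct (SOME vs. distinct vs \<and> set vs = verts G) \<and>
        set (SOME vs. distinct vs \<and> set vs = verts G) = verts G"
    by (rule someI[where x = vs]) (use assms in simp)
  then show ?thesis
    unfolding graph_char_poly_def using assms by (intro char_poly_adj_matrix_unique) auto
qed


section \<open>The alternating group graph\<close>

text \<open>For a connection set \<open>T\<close> that is closed under inverses and does not contain the identity.\<close>

definition cayley_graph :: "('a, 'b) monoid_scheme \<Rightarrow> 'a set \<Rightarrow> 'a graph" where
  "cayley_graph \<Gamma> T = (carrier \<Gamma>, {{\<gamma>, t \<otimes>\<^bsub>\<Gamma>\<^esub> \<gamma>} | \<gamma> t. \<gamma> \<in> carrier \<Gamma> \<and> t \<in> T})"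

text \<open>The multiplication of \<^const>\<open>alt_group\<close> is composition of functions. Here products are read
  from left to right: \<open>\<sigma> \<otimes> \<tau>\<close> applies \<open>\<sigma>\<close> first.\<close>

definition alt_group_lr :: "nat \<Rightarrow> (nat \<Rightarrow> nat) monoid" where
  "alt_group_lr n = (alt_group n) \<lparr> mult := (\<lambda>\<sigma> \<tau>. \<tau> \<circ> \<sigma>) \<rparr>"

text \<open>The permutation \<^term>\<open>cycle_of_list [i, j, k]\<close> is the cycle mapping \<open>i\<close> to \<open>j\<close>, \<open>j\<close> to \<open>k\<close>
  and \<open>k\<close> to \<open>i\<close>.\<close>

definition AG_gens :: "nat \<Rightarrow> (nat \<Rightarrow> nat) set" where
  "AG_gens n = {cycle_of_list [1, 2, i] | i. i \<in> {3..n}} \<union> {cycle_of_list [1, i, 2] | i. i \<in> {3..n}}"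

definition AG :: "nat \<Rightarrow> (nat \<Rightarrow> nat) graph" where
  "AG n = cayley_graph (alt_group_lr n) (AG_gens n)"

lemma alt_group_lr_simps [simp]:
  "carrier (alt_group_lr n) = carrier (alt_group n)"
  "\<sigma> \<otimes>\<^bsub>alt_group_lr n\<^esub> \<tau> = \<tau> \<circ> \<sigma>"
  "\<one>\<^bsub>alt_group_lr n\<^esub> = id"
  by (simp_all add: alt_group_lr_def alt_group_one)

lemma alt_group_lr_is_group: "group (alt_group_lr n)"
proof -
  interpret A: group "alt_group n" by (rule alt_group_is_group)
  show ?thesis
  proof (rule groupI)
    fix x assume "x \<in> carrier (alt_group_lr n)"
    then have "x \<in> carrier (alt_group n)" by simp
    from A.r_inv_ex[OF this]
    show "\<exists>y\<in>carrier (alt_group_lr n). y \<otimes>\<^bsub>alt_group_lr n\<^esub> x = \<one>\<^bsub>alt_group_lr n\<^esub>"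
      by (simp add: alt_group_mult alt_group_one)
  qed (use A.m_closed A.one_closed in \<open>auto simp: alt_group_mult alt_group_one comp_assoc\<close>)
qed

lemma cycle3_apply:
  assumes "distinct [a, b, c]"
  shows "cycle_of_list [a, b, c] x = (if x = a then b else if x = b then c else if x = c then a else x)"
  using assms by (auto simp: transpose_def)

lemma AG_gens_subset: "AG_gens n \<subseteq> carrier (alt_group_lr n) - {\<one>\<^bsub>alt_group_lr n\<^esub>}"
proof
  fix t assume "t \<in> AG_gens n"
  then obtain a b c where t: "t = cycle_of_list [a, b, c]" and d: "distinct [a, b, c]"
    and sub: "{a, b, c} \<subseteq> {1..n}"
    by (fastforce simp: AG_gens_def)
  have ab: "transpose a b permutes {1..n}" and bc: "transpose b c permutes {1..n}"
    using sub by (auto intro: permutes_swap_id)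
  have "t permutes {1..n}"
    using permutes_compose[OF bc ab] by (simp add: t)
  moreover have "evenperm t"
    using d by (simp add: t evenperm_comp evenperm_swap permutation_swap_id)
  moreover have "t \<noteq> id"
    using d cycle3_apply[OF d, of a] by (auto simp: t simp del: cycle_of_list.simps)
  ultimately show "t \<in> carrier (alt_group_lr n) - {\<one>\<^bsub>alt_group_lr n\<^esub>}"
    by (simp add: alt_group_carrier)
qed

lemma AG_gens_inv: "(\<lambda>t. inv\<^bsub>alt_group_lr n\<^esub> t) ` AG_gens n = AG_gens n"
proof -
  interpret G: group "alt_group_lr n" by (rule alt_group_lr_is_group)
  have inv: "inv\<^bsub>alt_group_lr n\<^esub> (cycle_of_list [1, 2, i]) = cycle_of_list [1, i, 2]"
    "inv\<^bsub>alt_group_lr n\<^esub> (cycle_of_list [1, i, 2]) = cycle_of_list [1, 2, i]" if i: "i \<in> {3..n}" for i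
  proof -
    have 1: "cycle_of_list [1, 2, i] \<in> AG_gens n" and 2: "cycle_of_list [1, i, 2] \<in> AG_gens n"
      using i unfolding AG_gens_def by blast+
    have mem: "cycle_of_list [1, 2, i] \<in> carrier (alt_group_lr n)"
      "cycle_of_list [1, i, 2] \<in> carrier (alt_group_lr n)"
      using 1 2 AG_gens_subset by blast+
    have d: "distinct [1, 2, i]" "distinct [1, i, 2]" using i by auto
    have eq: "cycle_of_list [1, 2, i] \<circ> cycle_of_list [1, i, 2] = id"
      "cycle_of_list [1, i, 2] \<circ> cycle_of_list [1, 2, i] = id"
      unfolding fun_eq_iff o_apply cycle3_apply[OF d(1)] cycle3_apply[OF d(2)] id_apply
      by (use i in force)+
    show "inv\<^bsub>alt_group_lr n\<^esub> (cycle_of_list [1, 2, i]) = cycle_of_list [1, i, 2]"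
      by (rule G.inv_equality) (use mem eq in \<open>simp_all del: cycle_of_list.simps\<close>)
    show "inv\<^bsub>alt_group_lr n\<^esub> (cycle_of_list [1, i, 2]) = cycle_of_list [1, 2, i]"
      by (rule G.inv_equality) (use mem eq in \<open>simp_all del: cycle_of_list.simps\<close>)
  qed
  have "(\<lambda>t. inv\<^bsub>alt_group_lr n\<^esub> t) ` AG_gens n =
    {inv\<^bsub>alt_group_lr n\<^esub> (cycle_of_list [1, 2, i]) | i. i \<in> {3..n}} \<union>
    {inv\<^bsub>alt_group_lr n\<^esub> (cycle_of_list [1, i, 2]) | i. i \<in> {3..n}}"
    unfolding AG_gens_def by blast
  also have "\<dots> = {cycle_of_list [1, i, 2] | i. i \<in> {3..n}} \<union> {cycle_of_list [1, 2, i] | i. i \<in> {3..n}}"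
    using inv by (intro arg_cong2[where f = "(\<union>)"] Collect_cong ex_cong1) (auto simp del: cycle_of_list.simps)
  also have "\<dots> = AG_gens n"
    unfolding AG_gens_def by blast
  finally show ?thesis .
qed

end

theory Submission
  imports Defs "HOL-Analysis.Function_Topology"
begin

text \<open>The graph is regular of degree \<open>2n - 4\<close>, so it suffices to bound the quadratic form of the
  adjacency operator on functions with sum zero by \<open>2n - 6\<close>; this goes by induction on \<open>n\<close>.
  A maximiser of the Rayleigh quotient is an eigenfunction \<open>f\<close> with some eigenvalue \<open>\<mu>\<close>. Fix a
  letter \<open>i\<close>. The sums of \<open>f\<close> over the sets \<open>{\<gamma>. \<gamma> k = i}\<close>, as \<open>k\<close> varies, form an eigenvector of
  an explicit \<open>n \<times> n\<close> quotient matrix, so they all vanish if \<open>\<mu> > 2n - 6\<close>. In particular \<open>f\<close>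
  has sum zero on every coset \<open>{\<gamma>. \<gamma> n = i}\<close>. The edges inside the cosets form copies of
  \<open>AG\<^sub>n\<^sub>-\<^sub>1\<close>, where the induction hypothesis gives \<open>2n - 8\<close>, and the remaining edges form a
  2-regular graph, which contributes at most 2; hence \<open>\<mu> \<le> 2n - 6\<close> after all.

  To pass to algebraic multiplicities, subtract the first row from the others: this splits off a
  factor \<open>x - (2n - 4)\<close> of the characteristic polynomial, and an eigenvector of the remaining block
  is an eigenfunction of the adjacency operator modulo constants.\<close>

section \<open>Maximising a quadratic form on the unit sphere\<close>

text \<open>Tychonoff's theorem for the product topology on a function type. It supplies the
  compactness for maximising over functions.\<close>

lemma compact_PiE_UNIV:
  assumes "\<And>i. compact (S i)"
  shows "compact (PiE UNIV S)"
  using compactin_PiE[of "\<lambda>_. euclidean" UNIV S] assms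
  by (simp add: euclidean_product_topology)

text \<open>For small \<open>t\<close> a nonzero linear term would dominate and take both signs.
  This serves as the first-order condition at a maximum.\<close>

lemma linear_coeff_zero:
  fixes b c :: real
  assumes "\<And>t. 0 \<le> 2 * t * b + t\<^sup>2 * c"
  shows "b = 0"
proof (rule ccontr)
  assume b: "b \<noteq> 0"
  have "b\<^sup>2 > 0" using b by simp
  \<comment> \<open>\<open>a\<close> exceeds both 0 and \<open>c\<close>, so
    \<open>c - 2 * a\<close> is negative.\<close>
  define a where "a = \<bar>c\<bar> + 1"
  have a: "a > 0" "c < a" by (auto simp: a_def)
  have "2 * (-b/a) * b + (-b/a)\<^sup>2 * c = b\<^sup>2 * (c - 2 * a) / a\<^sup>2"
    using a by (simp add: field_simps power2_eq_square)
  also have "\<dots> < 0" using a \<open>b\<^sup>2 > 0\<close> by (simp add: divide_neg_pos mult_pos_neg)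
  finally show False using assms[of "-b/a"] by simp
qed

text \<open>By compactness the Rayleigh quotient attains its maximum. A maximiser is an
  eigenfunction whose eigenvalue is that maximum, and \<open>ev\<close> bounds it.\<close>

lemma symmetric_form_le:
  fixes K :: "'a \<Rightarrow> 'a \<Rightarrow> real"
  assumes fin: "finite X"
    and sym: "\<And>x y. x \<in> X \<Longrightarrow> y \<in> X \<Longrightarrow> K x y = K y x"
    and ev: "\<And>f \<mu>. \<exists>x\<in>X. f x \<noteq> 0 \<Longrightarrow> (\<And>x. x \<in> X \<Longrightarrow> (\<Sum>y\<in>X. K x y * f y) = \<mu> * f x) \<Longrightarrow> \<mu> \<le> c"
  shows "(\<Sum>x\<in>X. f x * (\<Sum>y\<in>X. K x y * f y)) \<le> c * (\<Sum>x\<in>X. (f x)\<^sup>2)"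
proof -
  define N where "N f = (\<Sum>x\<in>X. (f x)\<^sup>2)" for f :: "'a \<Rightarrow> real"
  define B where "B f g = (\<Sum>x\<in>X. f x * (\<Sum>y\<in>X. K x y * g y))" for f g
  \<comment> \<open>\<open>N\<close> sees only the values on \<open>X\<close>. Fixing the others at
    0 makes the sphere a closed subset of a compact box; the bounds -1 and 1 follow from
    \<open>N f = 1\<close>.\<close>
  define D where "D = (PiE UNIV (\<lambda>x. if x \<in> X then {-1..1} else {0::real})) \<inter> {f. N f = 1}"
  have N0: "N f = 0 \<longleftrightarrow> (\<forall>x\<in>X. f x = 0)" for f
    unfolding N_def using fin by (subst sum_nonneg_eq_0_iff) auto
  have contN: "continuous_on UNIV N" unfolding N_def
    by (intro continuous_intros continuous_on_product_coordinates)
  have contB: "continuous_on UNIV (\<lambda>f. B f f)" unfolding B_def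
    by (intro continuous_intros continuous_on_product_coordinates)
  have "compact D" unfolding D_def
    by (intro compact_Int_closed compact_PiE_UNIV closed_Collect_eq contN) auto
  have scale: "N (\<lambda>x. a * g x) = a\<^sup>2 * N g" "B (\<lambda>x. a * g x) (\<lambda>x. a * g x) = a\<^sup>2 * B g g" for a g
    by (simp_all add: N_def B_def power_mult_distrib sum_distrib_left power2_eq_square mult_ac)
  have normalize: "\<exists>h\<in>D. B g g = N g * B h h" if "N g \<noteq> 0" for g
  proof
    define h where "h = (\<lambda>x. if x \<in> X then 1 / sqrt (N g) * g x else 0)"
    have "N g \<ge> 0" unfolding N_def by (simp add: sum_nonneg)
    with that have pos: "N g > 0" by simp
    have eq: "N h = N (\<lambda>x. 1 / sqrt (N g) * g x)"
      "B h h = B (\<lambda>x. 1 / sqrt (N g) * g x) (\<lambda>x. 1 / sqrt (N g) * g x)"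
      by (simp_all add: N_def B_def h_def)
    have Nh: "N h = 1" unfolding eq(1) scale using pos by (simp add: power_divide)
    have "\<bar>h x\<bar> \<le> 1" if "x \<in> X" for x
    proof -
      have "(h x)\<^sup>2 \<le> N h" unfolding N_def using that fin by (intro member_le_sum) auto
      then show ?thesis using Nh by (simp add: abs_square_le_1)
    qed
    then have box: "-1 \<le> h x \<and> h x \<le> 1" if "x \<in> X" for x
      using that abs_le_iff[of "h x" 1] by (smt (verit))
    show "h \<in> D" unfolding D_def using Nh box by (auto simp: h_def)
    show "B g g = N g * B h h" unfolding eq(2) scale using pos by (simp add: power_divide)
  qed
  show ?thesis
  proof (cases "N f = 0")
    case True
    then show ?thesis using N0[of f] by (simp add: N_def[symmetric])
  next
    case False
    with normalize have "D \<noteq> {}" by blast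
    have "continuous_on D (\<lambda>f. B f f)" using contB continuous_on_subset by blast
    from continuous_attains_sup[OF \<open>compact D\<close> \<open>D \<noteq> {}\<close> this]
    obtain h where h: "h \<in> D" and max: "\<And>g. g \<in> D \<Longrightarrow> B g g \<le> B h h" by blast
    define \<mu> where "\<mu> = B h h"
    have le: "B g g \<le> \<mu> * N g" for g
    proof (cases "N g = 0")
      case True
      then show ?thesis using N0[of g] by (simp add: B_def)
    next
      case False
      from normalize[OF this] obtain k where k: "k \<in> D" "B g g = N g * B k k" by blast
      have "N g \<ge> 0" unfolding N_def by (simp add: sum_nonneg)
      then show ?thesis using k max[OF k(1)] by (simp add: \<mu>_def mult_left_mono mult.commute)
    qed
    \<comment> \<open>\<open>r\<close> is the defect in the eigenvalue equation for the maximiser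
      \<open>h\<close>; varying \<open>h\<close> in the direction \<open>r\<close> shows that it
      vanishes.\<close>
    define r where "r x = \<mu> * h x - (\<Sum>y\<in>X. K x y * h y)" for x
    have Bsym: "B g k = B k g" for g k
    proof -
      have "B g k = (\<Sum>x\<in>X. \<Sum>y\<in>X. K x y * g x * k y)"
        by (simp add: B_def sum_distrib_left mult_ac)
      also have "\<dots> = (\<Sum>y\<in>X. \<Sum>x\<in>X. K x y * g x * k y)" by (rule sum.swap)
      also have "\<dots> = (\<Sum>y\<in>X. \<Sum>x\<in>X. K y x * g x * k y)"
        by (intro sum.cong refl) (simp add: sym)
      also have "\<dots> = B k g" by (simp add: B_def sum_distrib_left mult_ac)
      finally show ?thesis .
    qed
    have "(\<Sum>x\<in>X. r x * r x) = 0"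
    \<comment> \<open>At \<open>h + t * r\<close> the constant terms of \<open>le\<close> cancel,
      since \<open>N h = 1\<close> and \<open>B h h = \<mu>\<close>. The linear term left over is
      \<open>2 * t\<close> times the sum of the squares of \<open>r\<close>.\<close>
    proof (rule linear_coeff_zero)
      fix t :: real
      have lin: "B (\<lambda>x. h x + t * r x) (\<lambda>x. h x + t * r x) = B h h + t * B h r + t * B r h + t\<^sup>2 * B r r"
        by (simp add: B_def algebra_simps sum.distrib sum_distrib_left power2_eq_square)
      have linN: "N (\<lambda>x. h x + t * r x) = N h + 2 * t * (\<Sum>x\<in>X. r x * h x) + t\<^sup>2 * N r"
        by (simp add: N_def algebra_simps sum.distrib sum_distrib_left power2_eq_square)
      have "(\<Sum>x\<in>X. r x * r x) = (\<Sum>x\<in>X. r x * (\<mu> * h x - (\<Sum>y\<in>X. K x y * h y)))"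
        by (simp add: r_def)
      also have "\<dots> = \<mu> * (\<Sum>x\<in>X. r x * h x) - B r h"
        by (simp add: B_def algebra_simps sum_subtractf sum_distrib_left)
      finally have rr: "(\<Sum>x\<in>X. r x * r x) = \<mu> * (\<Sum>x\<in>X. r x * h x) - B r h" .
      have "N h = 1" using h by (simp add: D_def)
      then show "0 \<le> 2 * t * (\<Sum>x\<in>X. r x * r x) + t\<^sup>2 * (\<mu> * N r - B r r)"
        using le[of "\<lambda>x. h x + t * r x"] unfolding lin linN rr Bsym[of h r]
        by (simp add: \<mu>_def[symmetric] algebra_simps)
    qed
    then have "\<forall>x\<in>X. r x = 0" using fin by (subst (asm) sum_nonneg_eq_0_iff) auto
    moreover have "\<exists>x\<in>X. h x \<noteq> 0" using h N0[of h] by (auto simp: D_def)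
    ultimately have "\<mu> \<le> c" by (intro ev[of h]) (auto simp: r_def)
    moreover have "N f \<ge> 0" unfolding N_def by (simp add: sum_nonneg)
    ultimately show ?thesis using le[of f] mult_right_mono[of \<mu> c "N f"]
      by (simp add: B_def N_def)
  qed
qed

section \<open>Characteristic polynomials and sorted root lists\<close>

text \<open>The all-ones vector is an eigenvector for \<open>d\<close>. Taking it as first basis
  vector makes the matrix block triangular, and the other diagonal block acts on the quotient modulo
  constants.\<close>

lemma char_poly_const_row_sums:
  fixes A :: "'a :: comm_ring_1 mat"
  assumes A: "A \<in> carrier_mat (Suc m) (Suc m)"
    and row: "\<And>i. i < Suc m \<Longrightarrow> (\<Sum>j<Suc m. A $$ (i, j)) = d"
  shows "char_poly A = [:-d, 1:] * char_poly (mat m m (\<lambda>(i, j). A $$ (Suc i, Suc j) - A $$ (0, Suc j)))"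
proof -
  let ?a = "mat 1 1 (\<lambda>_. A $$ (0, 0))"
  let ?r = "mat 1 m (\<lambda>(i, j). A $$ (0, Suc j))"
  let ?c = "mat m 1 (\<lambda>(i, j). A $$ (Suc i, 0))"
  let ?D = "mat m m (\<lambda>(i, j). A $$ (Suc i, Suc j))"
  let ?u = "mat m 1 (\<lambda>_. 1 :: 'a)"
  let ?B = "mat m m (\<lambda>(i, j). A $$ (Suc i, Suc j) - A $$ (0, Suc j))"
  \<comment> \<open>Multiplying by \<open>?P\<close> on the right puts the row sums into the first
    column; multiplying by its inverse \<open>?Q\<close> on the left subtracts the first row from
    the others.\<close>
  let ?P = "four_block_mat (1\<^sub>m 1) (0\<^sub>m 1 m) ?u (1\<^sub>m m)"
  let ?Q = "four_block_mat (1\<^sub>m 1) (0\<^sub>m 1 m) (- ?u) (1\<^sub>m m)"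
  let ?T = "four_block_mat (mat 1 1 (\<lambda>_. d)) ?r (0\<^sub>m m 1) ?B"
  have Ablock: "A = four_block_mat ?a ?r ?c ?D"
    using A by (intro eq_matI) auto
  have one: "four_block_mat (1\<^sub>m 1) (0\<^sub>m 1 m) (0\<^sub>m m 1) (1\<^sub>m m) = (1\<^sub>m (Suc m) :: 'a mat)"
    by (intro eq_matI) auto
  have inv: "four_block_mat (1\<^sub>m 1) (0\<^sub>m 1 m) U (1\<^sub>m m) * four_block_mat (1\<^sub>m 1) (0\<^sub>m 1 m) V (1\<^sub>m m)
      = (1\<^sub>m (Suc m) :: 'a mat)"
    if U: "U \<in> carrier_mat m 1" and V: "V \<in> carrier_mat m 1" and UV: "U + V = 0\<^sub>m m 1" for U V :: "'a mat"
  proof -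
    have "four_block_mat (1\<^sub>m 1) (0\<^sub>m 1 m) U (1\<^sub>m m) * four_block_mat (1\<^sub>m 1) (0\<^sub>m 1 m) V (1\<^sub>m m) =
      four_block_mat (1\<^sub>m 1 * 1\<^sub>m 1 + 0\<^sub>m 1 m * V) (1\<^sub>m 1 * 0\<^sub>m 1 m + 0\<^sub>m 1 m * 1\<^sub>m m)
        (U * 1\<^sub>m 1 + 1\<^sub>m m * V) (U * 0\<^sub>m 1 m + 1\<^sub>m m * 1\<^sub>m m)"
      by (rule mult_four_block_mat) (use U V in auto)
    then show ?thesis using U V UV one by simp
  qed
  have PQ: "?P * ?Q = 1\<^sub>m (Suc m)" by (rule inv) (auto intro!: eq_matI)
  have QP: "?Q * ?P = 1\<^sub>m (Suc m)" by (rule inv) (auto intro!: eq_matI)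
  have row': "A $$ (i, 0) + (\<Sum>j<m. A $$ (i, Suc j)) = d" if "i < Suc m" for i
    using row[OF that] by (subst (asm) sum.lessThan_Suc_shift) simp
  have AP: "A * ?P = four_block_mat (mat 1 1 (\<lambda>_. d)) ?r (mat m 1 (\<lambda>_. d)) ?D"
  proof -
    have "A * ?P = four_block_mat (?a * 1\<^sub>m 1 + ?r * ?u) (?a * 0\<^sub>m 1 m + ?r * 1\<^sub>m m)
       (?c * 1\<^sub>m 1 + ?D * ?u) (?c * 0\<^sub>m 1 m + ?D * 1\<^sub>m m)"
      by (subst Ablock, rule mult_four_block_mat) auto
    also have "?a * 1\<^sub>m 1 + ?r * ?u = mat 1 1 (\<lambda>_. d)"
      using row'[of 0] by (intro eq_matI) (auto simp: scalar_prod_def lessThan_atLeast0)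
    also have "?c * 1\<^sub>m 1 + ?D * ?u = mat m 1 (\<lambda>_. d)"
      using row' by (intro eq_matI) (auto simp: scalar_prod_def lessThan_atLeast0)
    finally show ?thesis by simp
  qed
  have QAP: "?Q * (A * ?P) = ?T"
  proof -
    have "?Q * (A * ?P) = four_block_mat (1\<^sub>m 1 * mat 1 1 (\<lambda>_. d) + 0\<^sub>m 1 m * mat m 1 (\<lambda>_. d))
       (1\<^sub>m 1 * ?r + 0\<^sub>m 1 m * ?D) (- ?u * mat 1 1 (\<lambda>_. d) + 1\<^sub>m m * mat m 1 (\<lambda>_. d)) (- ?u * ?r + 1\<^sub>m m * ?D)"
      unfolding AP by (rule mult_four_block_mat) auto
    also have "- ?u * mat 1 1 (\<lambda>_. d) + 1\<^sub>m m * mat m 1 (\<lambda>_. d) = 0\<^sub>m m 1"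
      by (intro eq_matI) (auto simp: scalar_prod_def)
    also have "- ?u * ?r + 1\<^sub>m m * ?D = ?B"
      by (intro eq_matI) (auto simp: scalar_prod_def)
    finally show ?thesis by simp
  qed
  have P: "?P \<in> carrier_mat (Suc m) (Suc m)" and Q: "?Q \<in> carrier_mat (Suc m) (Suc m)"
    and T: "?T \<in> carrier_mat (Suc m) (Suc m)" by auto
  have "?P * ?T * ?Q = ?P * (?Q * (A * ?P)) * ?Q" by (simp only: QAP)
  also have "?P * (?Q * (A * ?P)) = (?P * ?Q) * (A * ?P)"
    using P Q A by (intro assoc_mult_mat[symmetric]) auto
  also have "\<dots> = A * ?P" using A P unfolding PQ by (intro left_mult_one_mat[where nr="Suc m" and nc="Suc m"]) auto
  also have "A * ?P * ?Q = A * (?P * ?Q)" using P Q A by (intro assoc_mult_mat) auto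
  also have "\<dots> = A" unfolding PQ using A by simp
  finally have "A = ?P * ?T * ?Q" ..
  then have "similar_mat A ?T"
    using A P Q T PQ QP by (intro similar_matI[of _ _ ?P ?Q "Suc m"]) auto
  from char_poly_similar[OF this] have "char_poly A = char_poly ?T" .
  also have "\<dots> = char_poly (mat 1 1 (\<lambda>_. d)) * char_poly ?B"
    by (rule char_poly_four_block_zeros_col) auto
  also have "char_poly (mat 1 1 (\<lambda>_. d)) = [:-d, 1:]"
    by (subst char_poly_upper_triangular[of _ 1]) (auto simp: diag_mat_def)
  finally show ?thesis .
qed

text \<open>A sorted list is determined by its multiset, and appending \<open>b\<close> and
  \<open>a\<close> to the sorted \<open>R\<close> keeps it sorted. \<open>R\<close> may contain
  \<open>b\<close> again, as multiplicities require.\<close>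

lemma rev_sorted_list_of_multiset_top_two:
  fixes M :: "'a :: linorder multiset"
  assumes M: "M = {#a, b#} + R" and ab: "b \<le> a" and R: "\<And>x. x \<in># R \<Longrightarrow> x \<le> b"
  shows "\<exists>xs. rev (sorted_list_of_multiset M) = a # b # xs"
proof -
  let ?ys = "sorted_list_of_multiset R @ [b, a]"
  have "sorted ?ys" using ab R by (auto simp: sorted_append intro: order_trans)
  moreover have "mset ?ys = M" by (simp add: M)
  ultimately have "sorted_list_of_multiset M = ?ys"
    by (metis sorted_list_of_multiset_mset sorted_sort_id)
  then show ?thesis by simp
qed

section \<open>Generators, neighbours and the adjacency operator\<close>

text \<open>The listed 3-cycles are pairwise distinct: those of the first family send 1 to 2 and
  differ at 2, those of the second differ at 1 and never send it to 2.\<close>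

lemma sum_AG_gens:
  fixes F :: "(nat \<Rightarrow> nat) \<Rightarrow> 'a :: comm_monoid_add"
  shows "sum F (AG_gens n) = (\<Sum>i=3..n. F (cycle_of_list [1, 2, i]) + F (cycle_of_list [1, i, 2]))"
proof -
  let ?c = "\<lambda>i::nat. cycle_of_list [1, 2, i]" and ?c' = "\<lambda>i::nat. cycle_of_list [1, i, 2]"
  have val: "?c i 1 = 2" "?c i 2 = i" "?c' i 1 = i" if "i \<in> {3..n}" for i
    using that cycle3_apply[of 1 2 i] cycle3_apply[of 1 i 2] by (auto simp del: cycle_of_list.simps)
  have inj: "inj_on ?c {3..n}" "inj_on ?c' {3..n}"
    by (rule inj_onI, metis val(2)) (rule inj_onI, metis val(3))
  have disj: "?c ` {3..n} \<inter> ?c' ` {3..n} = {}"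
  proof -
    have "?c i \<noteq> ?c' j" if "i \<in> {3..n}" "j \<in> {3..n}" for i j
    proof
      assume "?c i = ?c' j"
      then have "2 = j" using val(1)[OF that(1)] val(3)[OF that(2)] by metis
      then show False using that by simp
    qed
    then show ?thesis by blast
  qed
  have "AG_gens n = ?c ` {3..n} \<union> ?c' ` {3..n}"
    unfolding AG_gens_def by blast
  then have "sum F (AG_gens n) = sum F (?c ` {3..n}) + sum F (?c' ` {3..n})"
    using disj by (simp only:) (rule sum.union_disjoint; simp)
  also have "\<dots> = (\<Sum>i=3..n. F (?c i)) + (\<Sum>i=3..n. F (?c' i))"
    using inj by (simp only: sum.reindex o_def)
  finally show ?thesis by (simp only: sum.distrib)
qed

lemma sum_AG_gens_Suc:
  fixes F :: "(nat \<Rightarrow> nat) \<Rightarrow> 'a :: comm_monoid_add"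
  assumes "n \<ge> 2"
  shows "sum F (AG_gens (Suc n)) =
    sum F (AG_gens n) + (F (cycle_of_list [1, 2, Suc n]) + F (cycle_of_list [1, Suc n, 2]))"
  using assms by (simp add: sum_AG_gens del: cycle_of_list.simps)

lemma card_AG_gens: "n \<ge> 2 \<Longrightarrow> real (card (AG_gens n)) = 2 * real n - 4"
  using sum_AG_gens[of "\<lambda>_. 1::real" n] by (simp add: of_nat_diff)

lemma finite_alt_group: "finite (carrier (alt_group n))"
  by (rule finite_subset[OF _ finite_permutations[of "{1..n}"]]) (auto simp: alt_group_carrier)

lemma alt_group_comp:
  "\<sigma> \<in> carrier (alt_group n) \<Longrightarrow> \<tau> \<in> carrier (alt_group n) \<Longrightarrow> \<sigma> \<circ> \<tau> \<in> carrier (alt_group n)"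
  using group.is_monoid[OF alt_group_is_group] monoid.m_closed by (fastforce simp: alt_group_mult)

lemma AG_gens_alt: "t \<in> AG_gens n \<Longrightarrow> t \<in> carrier (alt_group n)"
  using AG_gens_subset by auto

lemma inv_alt_group: "\<sigma> \<in> carrier (alt_group n) \<Longrightarrow> inv' \<sigma> \<in> carrier (alt_group n)"
  by (metis alt_group_inv_equality alt_group_is_group group.inv_closed)

lemma alt_group_inv_comp:
  assumes "\<sigma> \<in> carrier (alt_group n)"
  shows "\<sigma> \<circ> inv' \<sigma> = id" "inv' \<sigma> \<circ> \<sigma> = id"
  using assms by (auto simp: alt_group_carrier permutes_inv_o)

lemma inv_AG_gens:
  assumes "t \<in> AG_gens n" shows "inv' t \<in> AG_gens n"
proof -
  have t: "t \<in> carrier (alt_group n)" by (rule AG_gens_alt[OF assms])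
  interpret G: group "alt_group_lr n" by (rule alt_group_lr_is_group)
  have "inv\<^bsub>alt_group_lr n\<^esub> t = inv' t"
    by (rule G.inv_equality)
      (use t inv_alt_group[OF t] in \<open>simp_all add: alt_group_inv_comp\<close>)
  then show ?thesis using AG_gens_inv[of n] assms by (metis imageI)
qed

lemma bij_betw_comp_alt_group:
  assumes "t \<in> carrier (alt_group n)"
  shows "bij_betw (\<lambda>\<gamma>. \<gamma> \<circ> t) (carrier (alt_group n)) (carrier (alt_group n))"
proof (rule bij_betwI[where g = "\<lambda>\<gamma>. \<gamma> \<circ> inv' t"])
  show "(x \<circ> t) \<circ> inv' t = x" "(x \<circ> inv' t) \<circ> t = x" for x
    by (simp_all add: comp_assoc alt_group_inv_comp[OF assms])
qed (auto intro: alt_group_comp assms inv_alt_group)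

lemma sum_alt_group_comp:
  assumes "t \<in> carrier (alt_group n)"
  shows "(\<Sum>\<gamma>\<in>carrier (alt_group n). F (\<gamma> \<circ> t)) = sum F (carrier (alt_group n))"
  using sum.reindex_bij_betw[OF bij_betw_comp_alt_group[OF assms]] .

text \<open>With products read from left to right, the neighbour \<open>t \<otimes> \<gamma>\<close>
  is the function \<open>\<gamma> \<circ> t\<close>. An edge can arise from either end; closure of
  the generators under inverses makes the two cases coincide.\<close>

lemma AG_edge_iff:
  assumes "\<gamma> \<in> carrier (alt_group n)" "\<delta> \<in> carrier (alt_group n)"
  shows "{\<gamma>, \<delta>} \<in> edges (AG n) \<longleftrightarrow> \<delta> \<in> (\<lambda>t. \<gamma> \<circ> t) ` AG_gens n"
proof -
  have "{\<gamma>, \<delta>} \<in> edges (AG n) \<longleftrightarrow> (\<exists>\<gamma>'\<in>carrier (alt_group n). \<exists>t\<in>AG_gens n. {\<gamma>, \<delta>} = {\<gamma>', \<gamma>' \<circ> t})"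
    by (auto simp: AG_def cayley_graph_def)
  also have "\<dots> \<longleftrightarrow> (\<exists>t\<in>AG_gens n. \<delta> = \<gamma> \<circ> t \<or> \<gamma> = \<delta> \<circ> t)"
    using assms by (auto simp: doubleton_eq_iff)
  also have "\<dots> \<longleftrightarrow> (\<exists>t\<in>AG_gens n. \<delta> = \<gamma> \<circ> t)"
  proof -
    have "\<exists>t\<in>AG_gens n. \<delta> = \<gamma> \<circ> t" if "t \<in> AG_gens n" "\<gamma> = \<delta> \<circ> t" for t
    proof
      show "\<delta> = \<gamma> \<circ> inv' t"
        using that(2) by (simp add: comp_assoc alt_group_inv_comp[OF AG_gens_alt[OF that(1)]])
    qed (rule inv_AG_gens[OF that(1)])
    then show ?thesis by blast
  qed
  finally show ?thesis by blast
qed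

text \<open>Since \<open>\<gamma>\<close> can be cancelled, distinct generators lead to distinct
  neighbours, so a 0/1 row of the adjacency matrix acts as a sum over the generators.\<close>

lemma sum_AG_neighbours:
  fixes f :: "(nat \<Rightarrow> nat) \<Rightarrow> real"
  assumes \<gamma>: "\<gamma> \<in> carrier (alt_group n)"
  shows "(\<Sum>\<delta>\<in>carrier (alt_group n). (if {\<gamma>, \<delta>} \<in> edges (AG n) then 1 else 0) * f \<delta>)
    = (\<Sum>t\<in>AG_gens n. f (\<gamma> \<circ> t))"
proof -
  let ?N = "(\<lambda>t. \<gamma> \<circ> t) ` AG_gens n"
  have "(\<Sum>\<delta>\<in>carrier (alt_group n). (if {\<gamma>, \<delta>} \<in> edges (AG n) then 1 else 0) * f \<delta>)
    = (\<Sum>\<delta>\<in>carrier (alt_group n). if \<delta> \<in> ?N then f \<delta> else 0)"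
    using \<gamma> by (intro sum.cong) (auto simp: AG_edge_iff)
  also have "\<dots> = sum f (carrier (alt_group n) \<inter> ?N)"
    by (rule sum.inter_restrict[OF finite_alt_group, symmetric])
  also have "carrier (alt_group n) \<inter> ?N = ?N"
    using \<gamma> by (auto intro: alt_group_comp AG_gens_alt)
  also have "sum f ?N = (\<Sum>t\<in>AG_gens n. f (\<gamma> \<circ> t))"
  proof (rule sum.reindex_cong[of "\<lambda>t. \<gamma> \<circ> t"])
    show "inj_on (\<lambda>t. \<gamma> \<circ> t) (AG_gens n)"
      by (rule inj_on_inverseI[where g = "\<lambda>\<delta>. inv' \<gamma> \<circ> \<delta>"])
        (simp add: comp_assoc[symmetric] alt_group_inv_comp[OF \<gamma>])
  qed auto
  finally show ?thesis .
qed

section \<open>The quotient matrix and the ingredients of the induction\<close>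

text \<open>The sum on the left is the quadratic form of the quotient matrix of the partition of \<open>A\<^sub>n\<close>
  by the position of a fixed letter.\<close>

lemma quotient_form_le:
  fixes s :: "nat \<Rightarrow> real"
  assumes n: "n \<ge> 3" and sum0: "(\<Sum>k=1..n. s k) = 0"
  shows "(\<Sum>k=1..n. s k * (\<Sum>t\<in>AG_gens n. s (t k))) \<le> (2 * real n - 6) * (\<Sum>k=1..n. (s k)\<^sup>2)"
proof -
  define S2 where "S2 = (\<Sum>k=1..n. (s k)\<^sup>2)"
  \<comment> \<open>\<open>e i\<close> is the change that a 3-cycle on 1, 2 and \<open>i\<close>
    makes to the sum of squares. A cycle and its inverse yield the same three products, so it serves
    both.\<close>
  define e where "e i = s 1 * s 2 + s 2 * s i + s i * s 1 - (s 1)\<^sup>2 - (s 2)\<^sup>2 - (s i)\<^sup>2" for i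
  have split: "(\<Sum>k=1..n. f k) = f 1 + f 2 + (\<Sum>k=3..n. f k)" for f :: "nat \<Rightarrow> real"
  proof -
    have "{1..n} = insert 1 (insert 2 {3..n})" using n by auto
    then show ?thesis by (simp add: add.assoc)
  qed
  have cyc: "(\<Sum>k=1..n. s k * s (cycle_of_list [1, 2, i] k)) = S2 + e i"
    "(\<Sum>k=1..n. s k * s (cycle_of_list [1, i, 2] k)) = S2 + e i" if i: "i \<in> {3..n}" for i
  proof -
    have d: "distinct [1, 2, i]" "distinct [1, i, 2]" using i by auto
    have sp: "(\<Sum>k=1..n. f k) = f 1 + f 2 + f i + (\<Sum>k\<in>{1..n} - {1, 2, i}. f k)" for f :: "nat \<Rightarrow> real"
    proof -
      have "(\<Sum>k=1..n. f k) = (\<Sum>k\<in>{1, 2, i}. f k) + (\<Sum>k\<in>{1..n} - {1, 2, i}. f k)"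
        using i by (intro sum.subset_diff[THEN trans[OF _ add.commute]]) auto
      then show ?thesis using i by (simp add: add.assoc)
    qed
    have r: "(\<Sum>k\<in>{1..n} - {1, 2, i}. s k * s (cycle_of_list [1, 2, i] k)) = (\<Sum>k\<in>{1..n} - {1, 2, i}. (s k)\<^sup>2)"
      "(\<Sum>k\<in>{1..n} - {1, 2, i}. s k * s (cycle_of_list [1, i, 2] k)) = (\<Sum>k\<in>{1..n} - {1, 2, i}. (s k)\<^sup>2)"
      unfolding cycle3_apply[OF d(1)] cycle3_apply[OF d(2)]
      by (auto intro!: sum.cong simp: power2_eq_square)
    have v: "cycle_of_list [1, 2, i] 1 = 2" "cycle_of_list [1, 2, i] 2 = i" "cycle_of_list [1, 2, i] i = 1"
      "cycle_of_list [1, i, 2] 1 = i" "cycle_of_list [1, i, 2] 2 = 1" "cycle_of_list [1, i, 2] i = 2"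
      unfolding cycle3_apply[OF d(1)] cycle3_apply[OF d(2)] using i by auto
    show "(\<Sum>k=1..n. s k * s (cycle_of_list [1, 2, i] k)) = S2 + e i"
      "(\<Sum>k=1..n. s k * s (cycle_of_list [1, i, 2] k)) = S2 + e i"
      unfolding S2_def sp r v e_def by (simp_all add: algebra_simps)
  qed
  define q where "q = (\<Sum>k=3..n. (s k)\<^sup>2)"
  define p where "p = (\<Sum>k=3..n. s k)"
  \<comment> \<open>The sum-zero hypothesis enters here. With \<open>p\<close> and \<open>q\<close>
    eliminated, only \<open>S2\<close>, \<open>s 1\<close> and \<open>s 2\<close> remain.\<close>
  have p: "p = - (s 1 + s 2)" using sum0 split[of s] by (simp add: p_def)
  have q: "q = S2 - (s 1)\<^sup>2 - (s 2)\<^sup>2" using split[of "\<lambda>k. (s k)\<^sup>2"] by (simp add: q_def S2_def)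
  have "(\<Sum>k=1..n. s k * (\<Sum>t\<in>AG_gens n. s (t k))) = (\<Sum>t\<in>AG_gens n. \<Sum>k=1..n. s k * s (t k))"
    unfolding sum_distrib_left by (rule sum.swap)
  also have "\<dots> = (\<Sum>i=3..n. 2 * (S2 + e i))"
    unfolding sum_AG_gens sum.distrib[symmetric]
    by (intro sum.cong refl) (simp only: sum.distrib cyc mult_2[symmetric])
  also have "\<dots> = 2 * (real n - 2) * (S2 + s 1 * s 2 - (s 1)\<^sup>2 - (s 2)\<^sup>2) + 2 * (s 1 + s 2) * p - 2 * q"
    using n unfolding e_def p_def q_def
    by (simp add: sum.distrib sum_subtractf sum_distrib_left of_nat_diff algebra_simps)
  also have "\<dots> = (2 * real n - 6) * S2 - 2 * ((real n - 2) * ((s 1)\<^sup>2 + (s 2)\<^sup>2 - s 1 * s 2) + 2 * (s 1 * s 2))"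
    unfolding p q by (simp add: algebra_simps power2_eq_square)
  also have "\<dots> \<le> (2 * real n - 6) * S2"
  proof -
    have "0 \<le> (s 1 - s 2)\<^sup>2" "0 \<le> (s 1 + s 2)\<^sup>2" by simp_all
    then have nn: "0 \<le> (s 1)\<^sup>2 + (s 2)\<^sup>2 - s 1 * s 2" "0 \<le> (s 1)\<^sup>2 + (s 2)\<^sup>2 + s 1 * s 2"
      unfolding power2_sum power2_diff
      using zero_le_power2[of "s 1"] zero_le_power2[of "s 2"] by linarith+
    \<comment> \<open>As \<open>n - 2\<close> is at least 1, the subtracted bracket is at least
      \<open>(s 1)\<^sup>2 + (s 2)\<^sup>2 + s 1 * s 2\<close>, which is nonnegative.\<close>
    have mono: "1 * ((s 1)\<^sup>2 + (s 2)\<^sup>2 - s 1 * s 2) \<le> (real n - 2) * ((s 1)\<^sup>2 + (s 2)\<^sup>2 - s 1 * s 2)"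
      using n nn(1) by (intro mult_right_mono) auto
    define Z where "Z = (real n - 2) * ((s 1)\<^sup>2 + (s 2)\<^sup>2 - s 1 * s 2)"
    have "0 \<le> Z + 2 * (s 1 * s 2)"
    proof -
      define P Q where "P = s 1 * s 2" and "Q = (s 1)\<^sup>2 + (s 2)\<^sup>2"
      have "Q - P \<le> Z" using mono unfolding Z_def[symmetric] P_def Q_def by simp
      moreover have "0 \<le> Q + P" using nn(2) unfolding P_def Q_def .
      ultimately have "0 \<le> Z + 2 * P" by linarith
      then show ?thesis unfolding P_def .
    qed
    then show ?thesis unfolding Z_def by simp
  qed
  finally show ?thesis by (simp add: S2_def)
qed

lemma carrier_alt_group_2: "carrier (alt_group 2) = {id}"
proof -
  have "p = id" if p: "p permutes {1, 2::nat}" "evenperm p" for p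
  proof -
    have "p = id \<or> p = transpose 1 2" using p(1) by (rule permutes_doubleton_iff[THEN iffD1])
    then show ?thesis using p(2) by (auto simp: evenperm_swap)
  qed
  moreover have "{1..2} = {1, 2::nat}" by auto
  ultimately show ?thesis by (auto simp: alt_group_carrier permutes_id)
qed

text \<open>The generators in \<open>AG_gens n\<close> fix \<open>Suc n\<close>, so their edges stay
  inside the cosets on which \<open>\<gamma> (Suc n)\<close> is constant, and \<open>IH\<close>
  applies there. Each of the two remaining generators adds at most the squared norm of
  \<open>f\<close>, hence \<open>c + 2\<close>.\<close>

lemma coset_form_le:
  fixes f :: "(nat \<Rightarrow> nat) \<Rightarrow> real"
  assumes n: "n \<ge> 2"
    and IH: "\<And>g :: (nat \<Rightarrow> nat) \<Rightarrow> real. sum g (carrier (alt_group n)) = 0 \<Longrightarrow>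
      (\<Sum>\<gamma>\<in>carrier (alt_group n). g \<gamma> * (\<Sum>t\<in>AG_gens n. g (\<gamma> \<circ> t)))
        \<le> c * (\<Sum>\<gamma>\<in>carrier (alt_group n). (g \<gamma>)\<^sup>2)"
    and zero: "\<And>i. (\<Sum>\<gamma> | \<gamma> \<in> carrier (alt_group (Suc n)) \<and> \<gamma> (Suc n) = i. f \<gamma>) = 0"
  shows "(\<Sum>\<gamma>\<in>carrier (alt_group (Suc n)). f \<gamma> * (\<Sum>t\<in>AG_gens (Suc n). f (\<gamma> \<circ> t)))
    \<le> (c + 2) * (\<Sum>\<gamma>\<in>carrier (alt_group (Suc n)). (f \<gamma>)\<^sup>2)"
proof -
  let ?A = "carrier (alt_group n)" and ?A' = "carrier (alt_group (Suc n))"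
  let ?C = "\<lambda>i. {\<gamma>. \<gamma> \<in> ?A' \<and> \<gamma> (Suc n) = i}"
  have sub: "?A \<subseteq> ?A'"
    using permutes_subset[of _ "{1..n}" "{1..Suc n}"] by (auto simp: alt_group_carrier)
  have "\<gamma> (Suc n) \<in> {1..Suc n}" if "\<gamma> \<in> ?A'" for \<gamma>
    using that permutes_in_image[of \<gamma> "{1..Suc n}" "Suc n"] by (simp add: alt_group_carrier)
  then have group_sum: "(\<Sum>i=1..Suc n. sum F (?C i)) = sum F ?A'" for F :: "(nat \<Rightarrow> nat) \<Rightarrow> real"
    by (intro sum.group finite_alt_group) auto
  have coset: "(\<Sum>\<gamma>\<in>?C i. f \<gamma> * (\<Sum>t\<in>AG_gens n. f (\<gamma> \<circ> t))) \<le> c * (\<Sum>\<gamma>\<in>?C i. (f \<gamma>)\<^sup>2)" for i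
  proof (cases "?C i = {}")
    case True
    then show ?thesis by (simp only: True sum.empty mult_zero_right)
  next
    case False
    then obtain \<rho> where \<rho>: "\<rho> \<in> ?A'" "\<rho> (Suc n) = i" by blast
    note inv_\<rho> = alt_group_inv_comp[OF \<rho>(1)]
    \<comment> \<open>Composition with \<open>\<rho>\<close> on the left carries the stabiliser of
      the last letter onto the coset and commutes with composing generators on the right.\<close>
    have bij: "bij_betw (\<lambda>\<delta>. \<rho> \<circ> \<delta>) ?A (?C i)"
    proof (rule bij_betwI[where g = "\<lambda>\<gamma>. inv' \<rho> \<circ> \<gamma>"])
      show "(\<lambda>\<delta>. \<rho> \<circ> \<delta>) \<in> ?A \<rightarrow> ?C i"
      proof
        fix \<delta> assume \<delta>: "\<delta> \<in> ?A"
        then have "\<delta> (Suc n) = Suc n"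
          using permutes_not_in[of \<delta> "{1..n}" "Suc n"] by (simp add: alt_group_carrier)
        moreover have "\<rho> \<circ> \<delta> \<in> ?A'" using \<rho>(1) \<delta> sub by (intro alt_group_comp) blast+
        ultimately show "\<rho> \<circ> \<delta> \<in> ?C i" using \<rho>(2) by simp
      qed
      show "(\<lambda>\<gamma>. inv' \<rho> \<circ> \<gamma>) \<in> ?C i \<rightarrow> ?A"
      proof
        fix \<gamma> assume \<gamma>: "\<gamma> \<in> ?C i"
        have mem: "inv' \<rho> \<circ> \<gamma> \<in> ?A'" using \<gamma> \<rho>(1) by (intro alt_group_comp inv_alt_group) blast+
        have "(inv' \<rho> \<circ> \<gamma>) (Suc n) = (inv' \<rho> \<circ> \<rho>) (Suc n)" using \<gamma> \<rho> by simp
        then have fix_last: "(inv' \<rho> \<circ> \<gamma>) (Suc n) = Suc n" by (simp only: inv_\<rho> id_apply)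
        have "(inv' \<rho> \<circ> \<gamma>) permutes {1..n}"
        proof (rule permutes_superset)
          show "(inv' \<rho> \<circ> \<gamma>) permutes {1..Suc n}" using mem by (simp add: alt_group_carrier)
          show "(inv' \<rho> \<circ> \<gamma>) x = x" if "x \<in> {1..Suc n} - {1..n}" for x
          proof -
            have "x = Suc n" using that by auto
            then show ?thesis using fix_last by simp
          qed
        qed
        then show "inv' \<rho> \<circ> \<gamma> \<in> ?A" using mem by (simp add: alt_group_carrier)
      qed
      show "inv' \<rho> \<circ> (\<rho> \<circ> x) = x" "\<rho> \<circ> (inv' \<rho> \<circ> x) = x" for x
        unfolding comp_assoc[symmetric] inv_\<rho> by simp_all
    qed
    have re: "sum F (?C i) = (\<Sum>\<delta>\<in>?A. F (\<rho> \<circ> \<delta>))" for F :: "(nat \<Rightarrow> nat) \<Rightarrow> real"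
      by (rule sum.reindex_bij_betw[OF bij, symmetric])
    show ?thesis
      using IH[of "\<lambda>\<delta>. f (\<rho> \<circ> \<delta>)"] zero[of i] unfolding re by (simp only: comp_assoc simp_thms)
  qed
  have "(\<Sum>\<gamma>\<in>?A'. f \<gamma> * (\<Sum>t\<in>AG_gens n. f (\<gamma> \<circ> t))) \<le> (\<Sum>i=1..Suc n. c * (\<Sum>\<gamma>\<in>?C i. (f \<gamma>)\<^sup>2))"
    unfolding group_sum[symmetric] by (intro sum_mono coset)
  then have inner: "(\<Sum>\<gamma>\<in>?A'. f \<gamma> * (\<Sum>t\<in>AG_gens n. f (\<gamma> \<circ> t))) \<le> c * (\<Sum>\<gamma>\<in>?A'. (f \<gamma>)\<^sup>2)"
    unfolding sum_distrib_left[symmetric] group_sum .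
  \<comment> \<open>Twice a product is at most the sum of the two squares, and composition with
    \<open>t\<close> permutes the group, so both squares have the same sum.\<close>
  have outer: "(\<Sum>\<gamma>\<in>?A'. f \<gamma> * f (\<gamma> \<circ> t)) \<le> (\<Sum>\<gamma>\<in>?A'. (f \<gamma>)\<^sup>2)" if "t \<in> AG_gens (Suc n)" for t
  proof -
    have "f \<gamma> * f (\<gamma> \<circ> t) \<le> ((f \<gamma>)\<^sup>2 + (f (\<gamma> \<circ> t))\<^sup>2) / 2" for \<gamma>
      using sum_squares_bound[of "f \<gamma>" "f (\<gamma> \<circ> t)"] by simp
    then have "(\<Sum>\<gamma>\<in>?A'. f \<gamma> * f (\<gamma> \<circ> t)) \<le> (\<Sum>\<gamma>\<in>?A'. ((f \<gamma>)\<^sup>2 + (f (\<gamma> \<circ> t))\<^sup>2) / 2)"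
      by (intro sum_mono)
    also have "\<dots> = ((\<Sum>\<gamma>\<in>?A'. (f \<gamma>)\<^sup>2) + (\<Sum>\<gamma>\<in>?A'. (f (\<gamma> \<circ> t))\<^sup>2)) / 2"
      by (simp add: sum_divide_distrib[symmetric] sum.distrib)
    also have "(\<Sum>\<gamma>\<in>?A'. (f (\<gamma> \<circ> t))\<^sup>2) = (\<Sum>\<gamma>\<in>?A'. (f \<gamma>)\<^sup>2)"
      by (rule sum_alt_group_comp[OF AG_gens_alt[OF that]])
    also have "((\<Sum>\<gamma>\<in>?A'. (f \<gamma>)\<^sup>2) + (\<Sum>\<gamma>\<in>?A'. (f \<gamma>)\<^sup>2)) / 2 = (\<Sum>\<gamma>\<in>?A'. (f \<gamma>)\<^sup>2)"
      by simp
    finally show ?thesis .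
  qed
  let ?c = "cycle_of_list [1, 2, Suc n]" and ?c' = "cycle_of_list [1, Suc n, 2]"
  have gens: "?c \<in> AG_gens (Suc n)" "?c' \<in> AG_gens (Suc n)"
  proof -
    have "Suc n \<in> {3..Suc n}" using n by simp
    then show "?c \<in> AG_gens (Suc n)" "?c' \<in> AG_gens (Suc n)" unfolding AG_gens_def by blast+
  qed
  have "(\<Sum>\<gamma>\<in>?A'. f \<gamma> * (\<Sum>t\<in>AG_gens (Suc n). f (\<gamma> \<circ> t))) =
    (\<Sum>\<gamma>\<in>?A'. f \<gamma> * (\<Sum>t\<in>AG_gens n. f (\<gamma> \<circ> t))) +
    ((\<Sum>\<gamma>\<in>?A'. f \<gamma> * f (\<gamma> \<circ> ?c)) + (\<Sum>\<gamma>\<in>?A'. f \<gamma> * f (\<gamma> \<circ> ?c')))"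
    unfolding sum_AG_gens_Suc[OF n] by (simp only: distrib_left sum.distrib)
  also have "\<dots> \<le> c * (\<Sum>\<gamma>\<in>?A'. (f \<gamma>)\<^sup>2) + ((\<Sum>\<gamma>\<in>?A'. (f \<gamma>)\<^sup>2) + (\<Sum>\<gamma>\<in>?A'. (f \<gamma>)\<^sup>2))"
    by (intro add_mono inner outer gens)
  also have "\<dots> = (c + 2) * (\<Sum>\<gamma>\<in>?A'. (f \<gamma>)\<^sup>2)" by (simp only: distrib_right mult_2)
  finally show ?thesis .
qed

text \<open>The value of \<open>\<gamma>\<close> at \<open>k\<close> is that of
  \<open>\<gamma> \<circ> t\<close> at \<open>inv' t k\<close>, so composing with \<open>t\<close>
  shifts the position sum to \<open>inv' t k\<close>. Closure under inverses then replaces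
  \<open>inv' t\<close> by \<open>t\<close>.\<close>

lemma position_sum_eigen:
  fixes f :: "(nat \<Rightarrow> nat) \<Rightarrow> real" and i :: nat
  assumes ev: "\<And>\<gamma>. \<gamma> \<in> carrier (alt_group n) \<Longrightarrow> (\<Sum>t\<in>AG_gens n. f (\<gamma> \<circ> t)) = \<mu> * f \<gamma>"
  defines "s \<equiv> \<lambda>k. \<Sum>\<gamma>\<in>carrier (alt_group n). if \<gamma> k = i then f \<gamma> else 0"
  shows "(\<Sum>t\<in>AG_gens n. s (t k)) = \<mu> * s k"
proof -
  let ?A = "carrier (alt_group n)"
  have shift: "(\<Sum>\<gamma>\<in>?A. if \<gamma> k = i then f (\<gamma> \<circ> t) else 0) = s (inv' t k)" if t: "t \<in> AG_gens n" for t
  proof -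
    have "t (inv' t k) = k"
      using alt_group_inv_comp(1)[OF AG_gens_alt[OF t]] by (metis comp_apply id_apply)
    then show ?thesis
      using sum_alt_group_comp[OF AG_gens_alt[OF t], of "\<lambda>\<gamma>. if \<gamma> (inv' t k) = i then f \<gamma> else 0"]
      by (simp add: s_def)
  qed
  have inv_inv: "inv' (inv' t) = t" if "t \<in> AG_gens n" for t
    using AG_gens_alt[OF that] by (auto simp: alt_group_carrier permutes_inv_inv)
  have "\<mu> * s k = (\<Sum>\<gamma>\<in>?A. if \<gamma> k = i then \<mu> * f \<gamma> else 0)"
    by (simp add: s_def sum_distrib_left if_distrib cong: if_cong)
  also have "\<dots> = (\<Sum>\<gamma>\<in>?A. \<Sum>t\<in>AG_gens n. if \<gamma> k = i then f (\<gamma> \<circ> t) else 0)"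
    by (intro sum.cong refl) (simp add: ev)
  also have "\<dots> = (\<Sum>t\<in>AG_gens n. s (inv' t k))"
    by (subst sum.swap) (simp add: shift)
  also have "\<dots> = (\<Sum>t\<in>AG_gens n. s (t k))"
    by (rule sum.reindex_bij_witness[where i = "inv'" and j = "inv'"]) (auto simp: inv_inv inv_AG_gens)
  finally show ?thesis ..
qed

text \<open>A permutation takes the value \<open>i\<close> at exactly one position. This supplies
  the sum-zero hypothesis of \<open>quotient_form_le\<close>.\<close>

lemma position_sum_total:
  fixes f :: "(nat \<Rightarrow> nat) \<Rightarrow> real"
  assumes i: "i \<in> {1..n}"
  shows "(\<Sum>k=1..n. \<Sum>\<gamma>\<in>carrier (alt_group n). if \<gamma> k = i then f \<gamma> else 0) = sum f (carrier (alt_group n))"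
proof (subst sum.swap, rule sum.cong[OF refl])
  fix \<gamma> assume \<gamma>: "\<gamma> \<in> carrier (alt_group n)"
  then have p: "\<gamma> permutes {1..n}" by (simp add: alt_group_carrier)
  have "(\<Sum>k=1..n. if \<gamma> k = i then f \<gamma> else 0) = (\<Sum>k=1..n. if k = i then f \<gamma> else 0)"
    by (rule sum.reindex_bij_betw[OF permutes_imp_bij[OF p], of "\<lambda>k. if k = i then f \<gamma> else 0"])
  also have "\<dots> = f \<gamma>" using i by simp
  finally show "(\<Sum>k=1..n. if \<gamma> k = i then f \<gamma> else 0) = f \<gamma>" .
qed

lemma sum_square_pos:
  fixes f :: "'a \<Rightarrow> real"
  assumes "finite X" "\<exists>x\<in>X. f x \<noteq> 0"
  shows "(\<Sum>x\<in>X. (f x)\<^sup>2) > 0"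
  using assms by (metis sum_pos2 zero_le_power2 zero_less_power2)

section \<open>The spectral gap on functions with sum zero\<close>

lemma AG_spectral_gap:
  fixes f :: "(nat \<Rightarrow> nat) \<Rightarrow> real"
  assumes "n \<ge> 2" "sum f (carrier (alt_group n)) = 0"
  shows "(\<Sum>\<gamma>\<in>carrier (alt_group n). f \<gamma> * (\<Sum>t\<in>AG_gens n. f (\<gamma> \<circ> t)))
    \<le> (2 * real n - 6) * (\<Sum>\<gamma>\<in>carrier (alt_group n). (f \<gamma>)\<^sup>2)"
  using assms
proof (induction n arbitrary: f rule: nat_induct_at_least)
  \<comment> \<open>The bound is -2 here, but the group is trivial and sum zero forces
    \<open>f\<close> to vanish on it.\<close>
  case base
  then show ?case by (simp add: carrier_alt_group_2)
next
  case (Suc n f)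
  define m where "m = Suc n"
  have m: "m \<ge> 3" using Suc.hyps by (simp add: m_def)
  let ?A = "carrier (alt_group m)"
  let ?d = "2 * real m - 4"
  let ?a = "\<lambda>\<gamma> \<delta>. if {\<gamma>, \<delta>} \<in> edges (AG m) then 1 else 0 :: real"
  \<comment> \<open>\<open>symmetric_form_le\<close> admits no side condition, so \<open>?d\<close>
    is subtracted from every entry. This leaves the form unchanged on functions with sum zero and
    moves the eigenvalue of the constants to \<open>?d * (1 - real (card ?A))\<close>.\<close>
  have row: "(\<Sum>\<delta>\<in>?A. (?a \<gamma> \<delta> - ?d) * g \<delta>) = (\<Sum>t\<in>AG_gens m. g (\<gamma> \<circ> t)) - ?d * sum g ?A"
    if "\<gamma> \<in> ?A" for g \<gamma>
    using sum_AG_neighbours[OF that, of g]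
    by (simp add: left_diff_distrib sum_subtractf sum_distrib_left)
  have "(\<Sum>\<gamma>\<in>?A. f \<gamma> * (\<Sum>\<delta>\<in>?A. (?a \<gamma> \<delta> - ?d) * f \<delta>)) \<le> (2 * real m - 6) * (\<Sum>\<gamma>\<in>?A. (f \<gamma>)\<^sup>2)"
  proof (rule symmetric_form_le[OF finite_alt_group])
    show "?a \<gamma> \<delta> - ?d = ?a \<delta> \<gamma> - ?d" for \<gamma> \<delta> by (simp add: insert_commute)
  next
    fix g \<mu> assume nz: "\<exists>\<gamma>\<in>?A. g \<gamma> \<noteq> 0"
      and eigen: "\<And>\<gamma>. \<gamma> \<in> ?A \<Longrightarrow> (\<Sum>\<delta>\<in>?A. (?a \<gamma> \<delta> - ?d) * g \<delta>) = \<mu> * g \<gamma>"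
    have ev: "(\<Sum>t\<in>AG_gens m. g (\<gamma> \<circ> t)) - ?d * sum g ?A = \<mu> * g \<gamma>" if "\<gamma> \<in> ?A" for \<gamma>
      by (rule trans[OF row[OF that, symmetric] eigen[OF that]])
    show "\<mu> \<le> 2 * real m - 6"
    proof (cases "sum g ?A = 0")
      \<comment> \<open>If \<open>g\<close> has nonzero sum, summing the eigenvalue equation over
        the group forces \<open>\<mu>\<close> to be the shifted eigenvalue of the constants, which
        is at most 0.\<close>
      case False
      have "\<mu> * sum g ?A = (\<Sum>\<gamma>\<in>?A. \<Sum>t\<in>AG_gens m. g (\<gamma> \<circ> t)) - real (card ?A) * (?d * sum g ?A)"
        by (simp add: sum_distrib_left ev[symmetric] sum_subtractf)
      also have "(\<Sum>\<gamma>\<in>?A. \<Sum>t\<in>AG_gens m. g (\<gamma> \<circ> t)) = (\<Sum>t\<in>AG_gens m. sum g ?A)"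
        by (subst sum.swap) (intro sum.cong refl sum_alt_group_comp AG_gens_alt)
      also have "\<dots> = ?d * sum g ?A" using m by (simp add: card_AG_gens)
      finally have "\<mu> * sum g ?A = (?d * (1 - real (card ?A))) * sum g ?A" by (simp add: algebra_simps)
      then have "\<mu> = ?d * (1 - real (card ?A))" using False by simp
      moreover have "card ?A \<ge> 1"
        using nz by (auto simp: Suc_le_eq card_gt_0_iff finite_alt_group)
      ultimately have "\<mu> \<le> 0" using m by (simp add: mult_nonneg_nonpos)
      then show ?thesis using m by simp
    next
      case True
      with ev have ev: "(\<Sum>t\<in>AG_gens m. g (\<gamma> \<circ> t)) = \<mu> * g \<gamma>" if "\<gamma> \<in> ?A" for \<gamma>
        using that by simp
      show ?thesis
      proof (rule ccontr)
        assume big: "\<not> \<mu> \<le> 2 * real m - 6"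
        have zero: "(\<Sum>\<gamma> | \<gamma> \<in> ?A \<and> \<gamma> m = i. g \<gamma>) = 0" for i
        proof (cases "i \<in> {1..m}")
          case i: True
          define s where "s k = (\<Sum>\<gamma>\<in>?A. if \<gamma> k = i then g \<gamma> else 0)" for k
          have s_ev: "(\<Sum>t\<in>AG_gens m. s (t k)) = \<mu> * s k" for k
            unfolding s_def by (rule position_sum_eigen[OF ev])
          have "(\<Sum>k=1..m. s k) = 0" unfolding s_def using position_sum_total[OF i] True by simp
          then have "(\<Sum>k=1..m. s k * (\<Sum>t\<in>AG_gens m. s (t k))) \<le> (2 * real m - 6) * (\<Sum>k=1..m. (s k)\<^sup>2)"
            by (rule quotient_form_le[OF m])
          also have "(\<Sum>k=1..m. s k * (\<Sum>t\<in>AG_gens m. s (t k))) = \<mu> * (\<Sum>k=1..m. (s k)\<^sup>2)"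
            by (simp add: s_ev sum_distrib_left power2_eq_square mult_ac)
          finally have "\<not> (\<Sum>k=1..m. (s k)\<^sup>2) > 0"
            using big mult_right_le_imp_le by blast
          then have "\<forall>k\<in>{1..m}. s k = 0" using sum_square_pos[of "{1..m}" s] by blast
          then have "s m = 0" using m by simp
          then show ?thesis unfolding s_def
            by (simp only: sum.inter_filter[OF finite_alt_group])
        next
          case False
          have "\<gamma> m \<in> {1..m}" if "\<gamma> \<in> ?A" for \<gamma>
            using that m permutes_in_image[of \<gamma> "{1..m}" m] by (simp add: alt_group_carrier)
          then have "{\<gamma>. \<gamma> \<in> ?A \<and> \<gamma> m = i} = {}" using False by blast
          then show ?thesis by (simp only: sum.empty)
        qed
        have "\<mu> * (\<Sum>\<gamma>\<in>?A. (g \<gamma>)\<^sup>2) = (\<Sum>\<gamma>\<in>?A. g \<gamma> * (\<Sum>t\<in>AG_gens m. g (\<gamma> \<circ> t)))"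
          by (simp add: ev sum_distrib_left power2_eq_square mult_ac)
        also have "\<dots> \<le> ((2 * real n - 6) + 2) * (\<Sum>\<gamma>\<in>?A. (g \<gamma>)\<^sup>2)"
          unfolding m_def by (rule coset_form_le[OF Suc.hyps Suc.IH zero[unfolded m_def]])
        \<comment> \<open>As \<open>m = Suc n\<close>, this bound equals
          \<open>2 * real m - 6\<close>.\<close>
        finally have "\<mu> \<le> (2 * real n - 6) + 2"
          by (rule mult_right_le_imp_le) (rule sum_square_pos[OF finite_alt_group nz])
        then show False using big by (simp add: m_def)
      qed
    qed
  qed
  moreover have "sum f ?A = 0" using Suc.prems by (simp add: m_def)
  ultimately have "(\<Sum>\<gamma>\<in>?A. f \<gamma> * (\<Sum>t\<in>AG_gens m. f (\<gamma> \<circ> t))) \<le> (2 * real m - 6) * (\<Sum>\<gamma>\<in>?A. (f \<gamma>)\<^sup>2)"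
    by (simp only: row mult_zero_right diff_zero cong: sum.cong)
  then show ?case by (simp only: m_def)
qed

section \<open>From the operator to the characteristic polynomial\<close>

lemma AG_adj_matrix_sum:
  fixes g :: "(nat \<Rightarrow> nat) \<Rightarrow> real"
  assumes vs: "distinct vs" "set vs = carrier (alt_group n)" and i: "i < length vs"
  shows "(\<Sum>j<length vs. adj_matrix (AG n) vs $$ (i, j) * g (vs ! j)) = (\<Sum>t\<in>AG_gens n. g (vs ! i \<circ> t))"
proof -
  have "(\<Sum>j<length vs. adj_matrix (AG n) vs $$ (i, j) * g (vs ! j)) =
    (\<Sum>j<length vs. (if {vs ! i, vs ! j} \<in> edges (AG n) then 1 else 0) * g (vs ! j))"
    using i by (intro sum.cong) (auto simp: adj_matrix_def)
  also have "\<dots> = (\<Sum>\<delta>\<in>set vs. (if {vs ! i, \<delta>} \<in> edges (AG n) then 1 else 0) * g \<delta>)"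
    by (rule sum.reindex_bij_betw[OF bij_betw_nth[OF vs(1) refl refl]])
  also have "\<dots> = (\<Sum>t\<in>AG_gens n. g (vs ! i \<circ> t))"
    unfolding vs(2) by (rule sum_AG_neighbours) (use vs i nth_mem in blast)
  finally show ?thesis .
qed

text \<open>Only two generators move a position \<open>j \<ge> 3\<close>, one to 1 and one to 2. The
  resulting term \<open>F 1 + F 2\<close> is the same for all such \<open>j\<close> and cancels in a
  difference; this takes two positions beyond 2, hence \<open>n \<ge> 4\<close>.\<close>

lemma AG_second_eigenvector:
  fixes \<gamma> :: "nat \<Rightarrow> nat"
  assumes n: "n \<ge> 4"
  defines "f \<equiv> \<lambda>\<gamma> :: nat \<Rightarrow> nat. (if \<gamma> 3 = 1 then 1 else 0) - (if \<gamma> 4 = 1 then 1 else 0) :: real"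
  shows "(\<Sum>t\<in>AG_gens n. f (\<gamma> \<circ> t)) = (2 * real n - 6) * f \<gamma>"
proof -
  have pos: "(\<Sum>t\<in>AG_gens n. F (t j)) = (2 * real n - 6) * F j + F 1 + F 2"
    if j: "j \<in> {3..n}" for j and F :: "nat \<Rightarrow> real"
  proof -
    have "F (cycle_of_list [1, 2, i] j) + F (cycle_of_list [1, i, 2] j) =
      2 * F j + (if i = j then F 1 + F 2 - 2 * F j else 0)" if "i \<in> {3..n}" for i
    proof -
      have d: "distinct [1, 2, i]" "distinct [1, i, 2]" using that by auto
      show ?thesis unfolding cycle3_apply[OF d(1)] cycle3_apply[OF d(2)] using j that by auto
    qed
    then have "(\<Sum>t\<in>AG_gens n. F (t j)) = (\<Sum>i=3..n. 2 * F j + (if i = j then F 1 + F 2 - 2 * F j else 0))"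
      unfolding sum_AG_gens by (intro sum.cong refl)
    also have "\<dots> = (2 * real n - 6) * F j + F 1 + F 2"
      using j n by (simp add: sum.distrib of_nat_diff algebra_simps)
    finally show ?thesis .
  qed
  have "(\<Sum>t\<in>AG_gens n. f (\<gamma> \<circ> t)) =
    (\<Sum>t\<in>AG_gens n. if \<gamma> (t 3) = 1 then 1 else 0) - (\<Sum>t\<in>AG_gens n. if \<gamma> (t 4) = 1 then 1 else 0)"
    by (simp add: f_def sum_subtractf)
  also have "\<dots> = (2 * real n - 6) * f \<gamma>"
    using n pos[of 3 "\<lambda>k. if \<gamma> k = 1 then 1 else 0"] pos[of 4 "\<lambda>k. if \<gamma> k = 1 then 1 else 0"]
    by (simp add: f_def algebra_simps)
  finally show ?thesis .
qed

text \<open>Subtracting the mean gives a nonzero \<open>h\<close> with sum zero that is still an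
  eigenfunction up to a constant. The constant is orthogonal to \<open>h\<close>, so the quadratic
  form at \<open>h\<close> is \<open>x\<close> times its squared norm and the spectral gap
  applies.\<close>

lemma eigen_modulo_constants_le:
  fixes g :: "(nat \<Rightarrow> nat) \<Rightarrow> real"
  assumes n: "n \<ge> 2"
    and g: "\<And>\<gamma>. \<gamma> \<in> carrier (alt_group n) \<Longrightarrow> (\<Sum>t\<in>AG_gens n. g (\<gamma> \<circ> t)) = x * g \<gamma> + c"
    and nonconst: "\<gamma>\<^sub>1 \<in> carrier (alt_group n)" "\<gamma>\<^sub>2 \<in> carrier (alt_group n)" "g \<gamma>\<^sub>1 \<noteq> g \<gamma>\<^sub>2"
  shows "x \<le> 2 * real n - 6"
proof -
  let ?A = "carrier (alt_group n)"
  define a where "a = sum g ?A / real (card ?A)"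
  define h where "h \<gamma> = g \<gamma> - a" for \<gamma>
  have "card ?A \<noteq> 0" using nonconst(1) finite_alt_group by auto
  then have h0: "sum h ?A = 0" by (simp add: h_def sum_subtractf a_def)
  define b where "b = x * a + c - real (card (AG_gens n)) * a"
  have h: "(\<Sum>t\<in>AG_gens n. h (\<gamma> \<circ> t)) = x * h \<gamma> + b" if "\<gamma> \<in> ?A" for \<gamma>
    using g[OF that] by (simp add: h_def b_def sum_subtractf algebra_simps)
  have "x * (\<Sum>\<gamma>\<in>?A. (h \<gamma>)\<^sup>2) = (\<Sum>\<gamma>\<in>?A. h \<gamma> * (x * h \<gamma> + b)) - b * sum h ?A"
    by (simp add: distrib_left sum.distrib sum_distrib_left power2_eq_square mult_ac)
  also have "\<dots> = (\<Sum>\<gamma>\<in>?A. h \<gamma> * (\<Sum>t\<in>AG_gens n. h (\<gamma> \<circ> t)))"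
    by (simp add: h h0)
  also have "\<dots> \<le> (2 * real n - 6) * (\<Sum>\<gamma>\<in>?A. (h \<gamma>)\<^sup>2)"
    by (rule AG_spectral_gap[OF n h0])
  finally have le: "x * (\<Sum>\<gamma>\<in>?A. (h \<gamma>)\<^sup>2) \<le> (2 * real n - 6) * (\<Sum>\<gamma>\<in>?A. (h \<gamma>)\<^sup>2)" .
  have "\<exists>\<gamma>\<in>?A. h \<gamma> \<noteq> 0"
  proof (rule ccontr)
    assume "\<not> ?thesis"
    then have "h \<gamma>\<^sub>1 = h \<gamma>\<^sub>2" using nonconst by simp
    then show False using nonconst(3) by (simp add: h_def)
  qed
  from le sum_square_pos[OF finite_alt_group this] show ?thesis by (rule mult_right_le_imp_le)
qed

text \<open>The cofactor \<open>p\<close> carries the spectrum with multiplicities, apart from one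
  copy of \<open>2 * real n - 4\<close>; the bound on its roots excludes a second copy.\<close>

lemma AG_char_poly:
  assumes n: "n \<ge> 4"
  obtains p where "graph_char_poly (AG n) = [:-(2 * real n - 4), 1:] * p" "p \<noteq> 0"
    "poly p (2 * real n - 6) = 0" "\<And>x. poly p x = 0 \<Longrightarrow> x \<le> 2 * real n - 6"
proof -
  let ?A = "carrier (alt_group n)" and ?d = "2 * real n - 4"
  obtain vs where vs: "set vs = ?A" "distinct vs"
    using finite_distinct_list[OF finite_alt_group] by blast
  have "id \<in> ?A" by (simp add: alt_group_carrier permutes_id)
  then have "vs \<noteq> []" using vs by auto
  then obtain m where m: "length vs = Suc m" by (cases vs) auto
  define M where "M = adj_matrix (AG n) vs"
  define N where "N = mat m m (\<lambda>(i, j). M $$ (Suc i, Suc j) - M $$ (0, Suc j))"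
  have M: "M \<in> carrier_mat (Suc m) (Suc m)" and N: "N \<in> carrier_mat m m"
    by (simp_all add: M_def adj_matrix_def m N_def)
  have adj: "(\<Sum>j<Suc m. M $$ (i, j) * g (vs ! j)) = (\<Sum>t\<in>AG_gens n. g (vs ! i \<circ> t))"
    if "i < Suc m" for i and g :: "(nat \<Rightarrow> nat) \<Rightarrow> real"
    using AG_adj_matrix_sum[OF vs(2,1), of i g] that by (simp only: M_def m)
  have vsA: "vs ! i \<in> ?A" if "i < Suc m" for i
    using that vs(1) m nth_mem by metis
  have char: "char_poly M = [:- ?d, 1:] * char_poly N"
    unfolding N_def
  proof (rule char_poly_const_row_sums[OF M])
    fix i assume "i < Suc m"
    from adj[OF this, of "\<lambda>_. 1"] show "(\<Sum>j<Suc m. M $$ (i, j)) = ?d"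
      using n by (simp add: card_AG_gens)
  qed
  show thesis
  proof (rule that[of "char_poly N"])
    show "graph_char_poly (AG n) = [:- ?d, 1:] * char_poly N"
      using graph_char_poly_eq[of vs "AG n"] vs char by (simp add: AG_def cayley_graph_def M_def)
    show "char_poly N \<noteq> 0"
      using degree_monic_char_poly[OF N] by auto
  next
    define f :: "(nat \<Rightarrow> nat) \<Rightarrow> real"
      where "f \<gamma> = (if \<gamma> 3 = 1 then 1 else 0) - (if \<gamma> 4 = 1 then 1 else 0)" for \<gamma>
    define v where "v = vec (Suc m) (\<lambda>i. f (vs ! i))"
    \<comment> \<open>This cycle sends 3 to 1 and fixes 4, so \<open>f\<close> is 1 there and the
      eigenvector is nonzero.\<close>
    let ?c = "cycle_of_list [1, 2, 3] :: nat \<Rightarrow> nat"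
    have "?c \<in> ?A"
    proof (rule AG_gens_alt)
      have "3 \<in> {3..n}" using n by simp
      then show "?c \<in> AG_gens n" unfolding AG_gens_def by blast
    qed
    then obtain i where i: "i < Suc m" "vs ! i = ?c" using vs m by (metis in_set_conv_nth)
    have "f ?c = 1"
      using cycle3_apply[of 1 2 "3::nat"] by (simp add: f_def del: cycle_of_list.simps)
    then have "v $ i \<noteq> 0" using i by (simp add: v_def)
    then have "v \<noteq> 0\<^sub>v (Suc m)" using i by auto
    moreover have "M *\<^sub>v v = (2 * real n - 6) \<cdot>\<^sub>v v"
    proof (rule eq_vecI)
      fix k assume "k < dim_vec ((2 * real n - 6) \<cdot>\<^sub>v v)"
      then have k: "k < Suc m" by (simp add: v_def)
      then have "(M *\<^sub>v v) $ k = (\<Sum>j<Suc m. M $$ (k, j) * f (vs ! j))"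
        using M by (auto simp: scalar_prod_def v_def lessThan_atLeast0 intro!: sum.cong)
      also have "\<dots> = (2 * real n - 6) * f (vs ! k)"
        unfolding adj[OF k] unfolding f_def by (rule AG_second_eigenvector[OF n])
      finally show "(M *\<^sub>v v) $ k = ((2 * real n - 6) \<cdot>\<^sub>v v) $ k" using k by (simp add: v_def)
    qed (use M in \<open>simp add: v_def\<close>)
    moreover have "v \<in> carrier_vec (Suc m)" by (simp add: v_def)
    ultimately have "eigenvalue M (2 * real n - 6)"
      using M unfolding eigenvalue_def eigenvector_def by (intro exI[of _ v]) simp
    then have "poly (char_poly M) (2 * real n - 6) = 0"
      by (simp add: eigenvalue_root_char_poly[OF M])
    \<comment> \<open>The linear factor does not vanish at this point, so the other factor
      does.\<close>
    then show "poly (char_poly N) (2 * real n - 6) = 0"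
      unfolding char poly_mult by simp
  next
    fix x assume "poly (char_poly N) x = 0"
    then obtain w where w: "w \<in> carrier_vec m" "w \<noteq> 0\<^sub>v m" "N *\<^sub>v w = x \<cdot>\<^sub>v w"
      using eigenvalue_root_char_poly[OF N] N by (auto simp: eigenvalue_def eigenvector_def)
    \<comment> \<open>A leading 0 lifts \<open>w\<close> from the quotient modulo constants. The
      rows of \<open>N\<close> are differences from row 0 of \<open>M\<close>, so \<open>M\<close>
      maps \<open>u\<close> to \<open>x\<close> times \<open>u\<close> plus the constant
      \<open>c\<close> that row 0 yields.\<close>
    define u where "u k = (case k of 0 \<Rightarrow> 0 | Suc j \<Rightarrow> w $ j)" for k
    define g where "g \<gamma> = u (the_inv_into {..<Suc m} ((!) vs) \<gamma>)" for \<gamma>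
    have "inj_on ((!) vs) {..<Suc m}"
      using vs(2) m by (auto intro!: inj_onI simp: nth_eq_iff_index_eq)
    then have g: "g (vs ! k) = u k" if "k < Suc m" for k
      unfolding g_def using that by (simp add: the_inv_into_f_f)
    define c where "c = (\<Sum>j<m. M $$ (0, Suc j) * w $ j)"
    have shift: "(\<Sum>j<Suc m. M $$ (k, j) * u j) = (\<Sum>j<m. M $$ (k, Suc j) * w $ j)" for k
      by (subst sum.lessThan_Suc_shift) (simp add: u_def)
    have ev: "(\<Sum>t\<in>AG_gens n. g (vs ! k \<circ> t)) = x * g (vs ! k) + c" if k: "k < Suc m" for k
    proof -
      have "(\<Sum>t\<in>AG_gens n. g (vs ! k \<circ> t)) = (\<Sum>j<m. M $$ (k, Suc j) * w $ j)"
        unfolding adj[OF k, symmetric] shift[symmetric] by (intro sum.cong) (auto simp: g)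
      also have "\<dots> = x * u k + c"
      proof (cases k)
        case (Suc i)
        then have i: "i < m" using k by simp
        have "x * w $ i = (N *\<^sub>v w) $ i" using w i by simp
        also have "\<dots> = (\<Sum>j<m. (M $$ (k, Suc j) - M $$ (0, Suc j)) * w $ j)"
          using w(1) i by (auto simp: N_def scalar_prod_def Suc lessThan_atLeast0 intro!: sum.cong)
        finally show ?thesis by (simp add: Suc u_def c_def left_diff_distrib sum_subtractf)
      qed (simp add: u_def c_def)
      finally show ?thesis using g[OF k] by simp
    qed
    \<comment> \<open>\<open>g\<close> vanishes at \<open>vs ! 0\<close>, so a nonzero entry of
      \<open>w\<close> makes it nonconstant.\<close>
    obtain i where i: "i < m" "w $ i \<noteq> 0"
      using w(1,2) by (metis carrier_vecD eq_vecI index_zero_vec(1,2))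
    show "x \<le> 2 * real n - 6"
    proof (rule eigen_modulo_constants_le[of n g x c "vs ! Suc i" "vs ! 0"])
      show "(\<Sum>t\<in>AG_gens n. g (\<gamma> \<circ> t)) = x * g \<gamma> + c" if "\<gamma> \<in> ?A" for \<gamma>
        using that ev vs(1) m by (metis in_set_conv_nth)
      show "g (vs ! Suc i) \<noteq> g (vs ! 0)" using i g by (simp add: u_def)
    qed (use n i vsA in auto)
  qed
qed

theorem theorem2p3:
  fixes n :: nat
  assumes "n \<ge> 4"
  shows "graph_eigenvalue 1 (AG n) = 2 * real n - 4 \<and>
         graph_eigenvalue 2 (AG n) = 2 * real n - 6"
proof -
  obtain p where p: "graph_char_poly (AG n) = [:-(2 * real n - 4), 1:] * p" "p \<noteq> 0"
    "poly p (2 * real n - 6) = 0" "\<And>x. poly p x = 0 \<Longrightarrow> x \<le> 2 * real n - 6"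
    using AG_char_poly[OF assms] by blast
  have "2 * real n - 6 \<in># proots p" using p by simp
  \<comment> \<open>One copy of the root is taken out; \<open>R\<close> may contain more.\<close>
  then obtain R where R: "proots p = {#2 * real n - 6#} + R"
    by (metis add_mset_add_single insert_DiffM union_commute)
  have "proots (graph_char_poly (AG n)) = {#2 * real n - 4#} + proots p"
    unfolding p(1) using p(2) by (subst proots_mult) auto
  then have M: "proots (graph_char_poly (AG n)) = {#2 * real n - 4, 2 * real n - 6#} + R"
    by (simp add: R)
  have "x \<le> 2 * real n - 6" if "x \<in># R" for x
  proof -
    have "x \<in># proots p" using that R by simp
    then show ?thesis using p by simp
  qed
  then obtain xs where "graph_eigenvalues (AG n) = (2 * real n - 4) # (2 * real n - 6) # xs"
    unfolding graph_eigenvalues_def using rev_sorted_list_of_multiset_top_two[OF M] by auto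
  then show ?thesis by (simp add: graph_eigenvalue_def)
qed

end
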